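(* Assume $n=o(T)$, $C_{\max}\ge 1$, and that $\phi\in(0,1)$ is bounded away from both $0$ and $1$ by a constant. Let the pairs $(\mathbf r_t,\mathbf c_t)\in\{0,1\}^n\times[0,C_{\max}]^n$, $t=1,\dots,T$, be drawn i.i.d. from an unknown distribution $\mathcal D$ such that the two boundary arms always satisfy $r_{i_{\max},t}=1$, $c_{i_{\max},t}=C_{\max}$ and $r_{i_{\min},t}=0$, $c_{i_{\min},t}=0$, and such that $p_i=\mathbf E[r_{i,t}]\in(0,1)$ and $\omega_i=\mathbf E[c_{i,t}]\in(0,C_{\max})$ for every arm $i\notin\{i_{\min},i_{\max}\}$. Let $$C^*=\min_{x\in\Delta_n}\sum_{i=1}^n x_i\omega_i\quad\text{subject to}\quad \sum_{i=1}^n x_ip_i\ge\phi ,$$ where $\Delta_n$ is the probability simplex. Then the Primal-Dual ACI algorithm run with $\Lambda=\frac{C_{\max}}{1-\phi}$ and $\eta=1/\sqrt T$ achieves regret $$\mathbf E\left[\sum_{t=1}^T\left(c_{i_t,t}-C^*\right)\right]\le O\!\left(\frac{C_{\max}}{1-\phi}\sqrt{nT\log(nT)}\right).$$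
   Context: Bandit model. There are $n\ge 2$ arms, two of which are distinguished: $i_{\max}$ (always reward $1$, cost $C_{\max}$) and $i_{\min}$ (always reward $0$, cost $0$). At each time $t\in\{1,\dots,T\}$ a success vector $\mathbf r_t\in\{0,1\}^n$ and a cost vector $\mathbf c_t\in[0,C_{\max}]^n$ are realized; the learner plays one arm $i_t$ and observes only $r_{i_t,t}$ and $c_{i_t,t}$. $\phi$ is a target success rate. Primal-Dual ACI algorithm with parameters $\Lambda>0$, $\eta>0$. Initialization: during times $t=1,\dots,n-2$ play each arm $i\notin\{i_{\min},i_{\max}\}$ exactly once; the dual variable is not updated during this phase. After initialization the dual variable is $\lambda_{n-1}=0$. For each time $t=n-1,n,\dots,T$: (1) For each arm $i\notin\{i_{\min},i_{\max}\}$ let $t_i$ be the number of times it has been played before time $t$, let $\mu_{i,t_i}$ and $\chi_{i,t_i}$ be the empirical means of its observed rewards and costs, let $\Delta_{i,t_i}=\sqrt{2\ln(nT)/t_i}$, and set $\bar R_{i,t-1}=\mu_{i,t_i}+\Delta_{i,t_i}$, $\bar C_{i,t-1}=\chi_{i,t_i}-C_{\max}\Delta_{i,t_i}$. For the boundary arms $t_i=\infty$, i.e. the exact values are used: $\bar R_{i_{\max},t-1}=1$, $\bar C_{i_{\max},t-1}=C_{\max}$, $\bar R_{i_{\min},t-1}=\bar C_{i_{\min},t-1}=0$. (2) If $\lambda_t\ge\Lambda$ play $i_t=i_{\max}$; else if $\lambda_t\le 0$ play $i_t=i_{\min}$; else play $i_t\in\arg\min_i\left(\bar C_{i,t-1}-\lambda_t\bar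 R_{i,t-1}\right)$ (minimum over all $n$ arms). (3) Observe $Y_t=r_{i_t,t}$ and set $\lambda_{t+1}=\lambda_t+\eta(\phi-Y_t)$. The expectation is over the draws of $(\mathbf r_t,\mathbf c_t)_{t\le T}$. *)

theory Defs
  imports "HOL-Probability.Probability" "HOL-Library.Landau_Symbols"
begin

section \<open>Stochastic bandits with a free and a safe boundary arm\<close>

text \<open>The arms are \<open>{1..n}\<close>. An outcome of one round is a pair \<open>(r, c)\<close> of a reward vector and a
  cost vector, both indexed by the arms.\<close>

type_synonym outcome = "(nat \<Rightarrow> real) \<times> (nat \<Rightarrow> real)"

definition mean_reward :: "outcome measure \<Rightarrow> nat \<Rightarrow> real" where
  "mean_reward D i = (\<integral>z. fst z i \<partial>D)"

definition mean_cost :: "outcome measure \<Rightarrow> nat \<Rightarrow> real" where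
  "mean_cost D i = (\<integral>z. snd z i \<partial>D)"

definition bandit_instance ::
  "nat \<Rightarrow> nat \<Rightarrow> nat \<Rightarrow> real \<Rightarrow> outcome measure \<Rightarrow> bool" where
  "bandit_instance n imin imax Cmax D \<longleftrightarrow>
     imin \<in> {1..n} \<and> imax \<in> {1..n} \<and> imin \<noteq> imax \<and>
     prob_space D \<and>
     sets D = sets ((\<Pi>\<^sub>M i\<in>{1..n}. borel) \<Otimes>\<^sub>M (\<Pi>\<^sub>M i\<in>{1..n}. borel)) \<and>
     (AE z in D. \<forall>i\<in>{1..n}. fst z i \<in> {0, 1} \<and> snd z i \<in> {0..Cmax}) \<and>
     (AE z in D. fst z imax = 1 \<and> snd z imax = Cmax \<and> fst z imin = 0 \<and> snd z imin = 0) \<and>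
     (\<forall>i\<in>{1..n} - {imin, imax}.
        mean_reward D i \<in> {0<..<1} \<and> mean_cost D i \<in> {0<..<Cmax})"

definition prob_simplex :: "nat \<Rightarrow> (nat \<Rightarrow> real) set" where
  "prob_simplex n = {x. (\<forall>i\<in>{1..n}. 0 \<le> x i) \<and> (\<Sum>i=1..n. x i) = 1}"

text \<open>For every instance and every \<open>\<phi> \<le> 1\<close> the feasible set contains the unit vector of \<open>imax\<close>, and
  the minimum of this linear program is attained, so the infimum is the minimum.\<close>

definition optimal_cost :: "nat \<Rightarrow> real \<Rightarrow> outcome measure \<Rightarrow> real" where
  "optimal_cost n \<phi> D =
     (INF x \<in> {x \<in> prob_simplex n. (\<Sum>i=1..n. x i * mean_reward D i) \<ge> \<phi>}.
        \<Sum>i=1..n. x i * mean_cost D i)"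


section \<open>Learners\<close>

text \<open>A history lists, in chronological order, the arm played in each past round with its observed
  reward and cost. A policy sees nothing but the history; round \<open>t\<close> is the one with a history
  of length \<open>t - 1\<close>.\<close>

type_synonym history = "(nat \<times> real \<times> real) list"

type_synonym policy = "history \<Rightarrow> nat"

primrec run :: "policy \<Rightarrow> (nat \<Rightarrow> outcome) \<Rightarrow> nat \<Rightarrow> history" where
  "run \<pi> z 0 = []"
| "run \<pi> z (Suc t) =
     (let h = run \<pi> z t; i = \<pi> h in h @ [(i, fst (z (Suc t)) i, snd (z (Suc t)) i)])"

definition played :: "policy \<Rightarrow> (nat \<Rightarrow> outcome) \<Rightarrow> nat \<Rightarrow> nat" where
  "played \<pi> z t = \<pi> (run \<pi> z (t - 1))"

abbreviation draws :: "nat \<Rightarrow> outcome measure \<Rightarrow> (nat \<Rightarrow> outcome) measure" where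
  "draws T D \<equiv> (\<Pi>\<^sub>M t\<in>{1..T}. D)"

text \<open>Needed for the expected regret to be meaningful: it only excludes non-measurable
  choices of the initialization order and among tied arms.\<close>

definition measurable_policy :: "nat \<Rightarrow> outcome measure \<Rightarrow> policy \<Rightarrow> bool" where
  "measurable_policy T D \<pi> \<longleftrightarrow>
     (\<forall>t\<in>{1..T}. (\<lambda>z. played \<pi> z t) \<in> draws T D \<rightarrow>\<^sub>M count_space UNIV)"

definition expected_regret :: "nat \<Rightarrow> nat \<Rightarrow> real \<Rightarrow> outcome measure \<Rightarrow> policy \<Rightarrow> real" where
  "expected_regret n T \<phi> D \<pi> =
     (\<integral>z. (\<Sum>t=1..T. snd (z t) (played \<pi> z t) - optimal_cost n \<phi> D) \<partial>draws T D)"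


section \<open>The Primal-Dual ACI algorithm\<close>

definition observations :: "history \<Rightarrow> nat \<Rightarrow> (real \<times> real) list" where
  "observations h i = map snd (filter (\<lambda>e. fst e = i) h)"

definition play_count :: "history \<Rightarrow> nat \<Rightarrow> nat" where
  "play_count h i = length (observations h i)"

definition empirical_reward :: "history \<Rightarrow> nat \<Rightarrow> real" where
  "empirical_reward h i = (\<Sum>y\<leftarrow>observations h i. fst y) / real (play_count h i)"

definition empirical_cost :: "history \<Rightarrow> nat \<Rightarrow> real" where
  "empirical_cost h i = (\<Sum>y\<leftarrow>observations h i. snd y) / real (play_count h i)"

definition radius :: "nat \<Rightarrow> nat \<Rightarrow> history \<Rightarrow> nat \<Rightarrow> real" where
  "radius n T h i = sqrt (2 * ln (real n * real T) / real (play_count h i))"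

definition reward_ucb :: "nat \<Rightarrow> nat \<Rightarrow> nat \<Rightarrow> nat \<Rightarrow> history \<Rightarrow> nat \<Rightarrow> real" where
  "reward_ucb n T imin imax h i =
     (if i = imax then 1 else if i = imin then 0
      else empirical_reward h i + radius n T h i)"

definition cost_lcb :: "nat \<Rightarrow> nat \<Rightarrow> nat \<Rightarrow> nat \<Rightarrow> real \<Rightarrow> history \<Rightarrow> nat \<Rightarrow> real" where
  "cost_lcb n T imin imax Cmax h i =
     (if i = imax then Cmax else if i = imin then 0
      else empirical_cost h i - Cmax * radius n T h i)"

text \<open>The value \<open>\<lambda>\<^sub>t\<close> for \<open>t = length h + 1\<close>. The first \<open>n - 2\<close> entries of the history form
  the initialization phase, which leaves the dual variable at \<open>0\<close>.\<close>

definition dual :: "nat \<Rightarrow> real \<Rightarrow> real \<Rightarrow> history \<Rightarrow> real" where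
  "dual n \<phi> \<eta> h = foldl (\<lambda>l (i, y, c). l + \<eta> * (\<phi> - y)) 0 (drop (n - 2) h)"

text \<open>The initialization order and the resolution of ties in the arg min are left open, so this is
  a property of policies. In the initialization phase, choosing among the \<open>n - 2\<close> non-boundary
  arms a not yet played one amounts to playing each of them exactly once.\<close>

definition primal_dual_ACI ::
  "nat \<Rightarrow> nat \<Rightarrow> nat \<Rightarrow> nat \<Rightarrow> real \<Rightarrow> real \<Rightarrow> real \<Rightarrow> real \<Rightarrow> policy \<Rightarrow> bool" where
  "primal_dual_ACI n T imin imax Cmax \<phi> \<Lambda> \<eta> \<pi> \<longleftrightarrow>
     (\<forall>h. length h < T \<longrightarrow>
        (if length h < n - 2 then \<pi> h \<in> {1..n} - {imin, imax} - fst ` set h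
         else if dual n \<phi> \<eta> h \<ge> \<Lambda> then \<pi> h = imax
         else if dual n \<phi> \<eta> h \<le> 0 then \<pi> h = imin
         else is_arg_min
                (\<lambda>i. cost_lcb n T imin imax Cmax h i
                     - dual n \<phi> \<eta> h * reward_ucb n T imin imax h i)
                (\<lambda>i. i \<in> {1..n}) (\<pi> h)))"

end

theory Submission
  imports Defs
begin

text \<open>By weak duality \<open>min\<^sub>i (\<omega>\<^sub>i - \<lambda> p\<^sub>i) + \<lambda> \<phi> \<le> C\<^sup>*\<close> for \<open>\<lambda> \<ge> 0\<close>, so as long as all
  confidence intervals are valid, the arm played against \<open>\<lambda>\<^sub>t\<close> satisfies
  \<open>\<omega> - C\<^sup>* \<le> \<lambda>\<^sub>t (p - \<phi>) + 4 \<Lambda> \<Delta>\<close>; for the two boundary rules this holds with \<open>\<Delta> = 0\<close> because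
  \<open>\<Lambda> (1 - \<phi>) = C\<^sub>m\<^sub>a\<^sub>x\<close>. Replacing means by realizations costs a sum of mean-zero terms. The dual
  terms telescope, since \<open>2 \<eta> \<lambda>\<^sub>t (Y\<^sub>t - \<phi>) \<le> \<lambda>\<^sub>t\<^sup>2 - \<lambda>\<^sub>t\<^sub>+\<^sub>1\<^sup>2 + \<eta>\<^sup>2\<close>, and contribute \<open>\<surd>T / 2\<close>. The radii
  \<open>\<Delta>\<close> sum to \<open>O(\<surd>(n T ln (n T)))\<close> by Cauchy-Schwarz over the arms. Some confidence interval fails with
  probability at most \<open>4 / T\<close>, by Hoeffding's inequality for adaptively chosen samples and a union
  bound over arms, rounds and play counts.\<close>

section \<open>Integration and concentration for adaptively sampled terms\<close>

text \<open>Integrating over coordinate \<open>t\<close> first leaves \<open>g\<close> as a constant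
  factor in front of the mean of \<open>f\<close>, which is zero. The almost sure bounds give the
  integrability that Fubini asks for.\<close>

lemma predictable_mean_zero:
  fixes g :: "(nat \<Rightarrow> 'a) \<Rightarrow> real" and f :: "'a \<Rightarrow> real"
  assumes D: "prob_space D" and t: "t \<in> {1..T}"
    and g[measurable]: "g \<in> borel_measurable (\<Pi>\<^sub>M t\<in>{1..T}. D)"
    and pred: "\<And>z y. g (z(t := y)) = g z"
    and f[measurable]: "f \<in> borel_measurable D" and "(\<integral>y. f y \<partial>D) = 0"
    and G: "AE z in (\<Pi>\<^sub>M t\<in>{1..T}. D). \<bar>g z\<bar> \<le> G"
    and F: "AE y in D. \<bar>f y\<bar> \<le> F"
  shows "integrable (\<Pi>\<^sub>M t\<in>{1..T}. D) (\<lambda>z. g z * f (z t))"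
    and "(\<integral>z. g z * f (z t) \<partial>(\<Pi>\<^sub>M t\<in>{1..T}. D)) = 0"
proof -
  let ?I = "{1..T} - {t}"
  interpret D: prob_space D by (rule D)
  interpret P: product_sigma_finite "\<lambda>_. D" by unfold_locales
  interpret M: prob_space "\<Pi>\<^sub>M t\<in>{1..T}. D" by (intro prob_space_PiM D)
  have T: "{1..T} = insert t ?I" using t by auto
  have tm[measurable]: "(\<lambda>z. z t) \<in> (\<Pi>\<^sub>M t\<in>{1..T}. D) \<rightarrow>\<^sub>M D"
    using t by simp
  have F': "AE z in (\<Pi>\<^sub>M t\<in>{1..T}. D). \<bar>f (z t)\<bar> \<le> F"
    by (intro AE_PiM_component D t F)
  show int: "integrable (\<Pi>\<^sub>M t\<in>{1..T}. D) (\<lambda>z. g z * f (z t))"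
  proof (rule M.integrable_const_bound)
    show "AE z in (\<Pi>\<^sub>M t\<in>{1..T}. D). norm (g z * f (z t)) \<le> G * F"
      using G F' by eventually_elim (auto simp: abs_mult intro!: mult_mono)
    have "(\<lambda>z. f (z t)) \<in> borel_measurable (\<Pi>\<^sub>M t\<in>{1..T}. D)" by (rule measurable_compose[OF tm f])
    then show "(\<lambda>z. g z * f (z t)) \<in> borel_measurable (\<Pi>\<^sub>M t\<in>{1..T}. D)" by (intro borel_measurable_times g)
  qed
  have "(\<integral>z. g z * f (z t) \<partial>(\<Pi>\<^sub>M t\<in>insert t ?I. D))
      = (\<integral>z. (\<integral>y. g (z(t := y)) * f ((z(t := y)) t) \<partial>D) \<partial>(\<Pi>\<^sub>M t\<in>?I. D))"
    by (rule P.product_integral_insert) (use int T in auto)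
  also have "\<dots> = 0" by (simp add: pred assms)
  finally show "(\<integral>z. g z * f (z t) \<partial>(\<Pi>\<^sub>M t\<in>{1..T}. D)) = 0"
    using T by simp
qed

text \<open>The compensated exponential of the sampled sum is a supermartingale. Integrating out the last
  coordinate first replaces conditional expectations.\<close>

lemma adaptive_exponential_moment:
  fixes f :: "'a \<Rightarrow> real" and A :: "nat \<Rightarrow> (nat \<Rightarrow> 'a) \<Rightarrow> bool"
  assumes D: "prob_space D" and f[measurable]: "f \<in> borel_measurable D"
    and mean: "(\<integral>y. f y \<partial>D) = 0" and range: "AE y in D. f y \<in> {a..b}"
    and A: "\<And>t. t \<in> {1..T} \<Longrightarrow> Measurable.pred (\<Pi>\<^sub>M t\<in>{1..T}. D) (A t)"
    and pred: "\<And>u t z y. u \<in> {1..t} \<Longrightarrow> t \<le> T \<Longrightarrow> A u (z(t := y)) = A u z"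
    and s: "s > 0" and "m \<le> T"
  shows "(\<integral>\<^sup>+z. exp (\<Sum>u=1..m. if A u z then s * f (z u) - s\<^sup>2 * (b - a)\<^sup>2 / 8 else 0)
            \<partial>(\<Pi>\<^sub>M t\<in>{1..T}. D)) \<le> 1"
  using \<open>m \<le> T\<close>
proof (induction m)
  case 0
  interpret M: prob_space "\<Pi>\<^sub>M t\<in>{1..T}. D" by (intro prob_space_PiM D)
  show ?case using M.emeasure_space_1 by simp
next
  case (Suc m)
  let ?t = "Suc m"
  let ?I = "{1..T} - {?t}"
  \<comment> \<open>\<open>c\<close> is the exponent of Hoeffding's lemma for a range of length
    \<open>b - a\<close>, so each compensated factor \<open>exp (s * f y - c)\<close> has mean at
    most 1.\<close>
  define c where "c = s\<^sup>2 * (b - a)\<^sup>2 / 8"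
  define W where "W m z = exp (\<Sum>u=1..m. if A u z then s * f (z u) - c else 0)" for m z
  interpret D: prob_space D by (rule D)
  interpret f: interval_bounded_random_variable D f a b
    by unfold_locales (use range in auto)
  interpret P: product_sigma_finite "\<lambda>_. D" by unfold_locales
  have T: "{1..T} = insert ?t ?I" using Suc.prems by auto
  have W_meas: "(\<lambda>z. ennreal (W j z)) \<in> borel_measurable (\<Pi>\<^sub>M t\<in>{1..T}. D)" if "j \<le> T" for j
  proof -
    have "(\<lambda>z. \<Sum>u=1..j. if A u z then s * f (z u) - c else 0) \<in> borel_measurable (\<Pi>\<^sub>M t\<in>{1..T}. D)"
    proof (rule borel_measurable_sum)
      fix u assume "u \<in> {1..j}"
      then have u: "u \<in> {1..T}" using that by auto
      note [measurable] = A[OF u] measurable_PiM_component_rev[OF u, of f "\<lambda>_. D" borel, OF f]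
      show "(\<lambda>z. if A u z then s * f (z u) - c else 0) \<in> borel_measurable (\<Pi>\<^sub>M t\<in>{1..T}. D)"
        by measurable
    qed
    then show ?thesis unfolding W_def by measurable
  qed
  have W_upd: "W m (z(?t := y)) = W m z" for z y
    unfolding W_def using Suc.prems
    by (intro arg_cong[where f = exp] sum.cong) (auto simp: pred)
  have inner: "(\<integral>\<^sup>+y. exp (s * f y - c) \<partial>D) \<le> 1"
  proof -
    have "(\<integral>\<^sup>+y. exp (s * f y - c) \<partial>D) = (\<integral>\<^sup>+y. ennreal (exp (-c)) * ennreal (exp (s * f y)) \<partial>D)"
      by (intro nn_integral_cong) (simp add: ennreal_mult[symmetric] exp_add[symmetric])
    also have "\<dots> = ennreal (exp (-c)) * (\<integral>\<^sup>+y. ennreal (exp (s * f y)) \<partial>D)"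
      by (rule nn_integral_cmult) measurable
    also have "\<dots> \<le> ennreal (exp (-c)) * ennreal (exp (s\<^sup>2 * (b - a)\<^sup>2 / 8))"
      by (intro mult_left_mono f.Hoeffdings_lemma_nn_integral_0 s mean) auto
    also have "\<dots> = 1" by (simp add: c_def ennreal_mult[symmetric] exp_add[symmetric])
    finally show ?thesis .
  qed
  have "(\<integral>\<^sup>+z. W ?t z \<partial>(\<Pi>\<^sub>M t\<in>insert ?t ?I. D))
      = (\<integral>\<^sup>+z. (\<integral>\<^sup>+y. W ?t (z(?t := y)) \<partial>D) \<partial>(\<Pi>\<^sub>M t\<in>?I. D))"
    by (rule P.product_nn_integral_insert) (use W_meas[OF Suc.prems] T in auto)
  also have "\<dots> \<le> (\<integral>\<^sup>+z. (\<integral>\<^sup>+y. W m (z(?t := y)) \<partial>D) \<partial>(\<Pi>\<^sub>M t\<in>?I. D))"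
  proof (rule nn_integral_mono)
    fix z
    \<comment> \<open>By \<open>pred\<close>, neither \<open>W m\<close> nor the decision
      \<open>A ?t\<close> depends on coordinate \<open>?t\<close>, so only \<open>f y\<close> varies
      in the inner integral.\<close>
    have eq: "W ?t (z(?t := y)) = W m z * (if A ?t z then exp (s * f y - c) else 1)" for y
    proof -
      have "W ?t (z(?t := y)) = W m (z(?t := y)) * (if A ?t z then exp (s * f y - c) else 1)"
        using Suc.prems by (simp add: W_def exp_add pred)
      then show ?thesis by (simp add: W_upd)
    qed
    have "(\<integral>\<^sup>+y. W ?t (z(?t := y)) \<partial>D)
        = ennreal (W m z) * (\<integral>\<^sup>+y. (if A ?t z then exp (s * f y - c) else 1) \<partial>D)"
      unfolding eq by (subst nn_integral_cmult[symmetric])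
        (auto simp: ennreal_mult[symmetric] W_def intro!: nn_integral_cong)
    also have "\<dots> \<le> ennreal (W m z) * 1"
      by (cases "A ?t z") (use mult_left_mono[OF inner, of "ennreal (W m z)"] in \<open>simp_all add: D.emeasure_space_1\<close>)
    also have "\<dots> = (\<integral>\<^sup>+y. W m (z(?t := y)) \<partial>D)" by (simp add: W_upd D.emeasure_space_1)
    finally show "(\<integral>\<^sup>+y. W ?t (z(?t := y)) \<partial>D) \<le> (\<integral>\<^sup>+y. W m (z(?t := y)) \<partial>D)" .
  qed
  \<comment> \<open>Since \<open>W m\<close> ignores coordinate \<open>?t\<close>, the integral over
    that coordinate merely restores the full product measure.\<close>
  also have "\<dots> = (\<integral>\<^sup>+z. W m z \<partial>(\<Pi>\<^sub>M t\<in>insert ?t ?I. D))"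
    by (rule P.product_nn_integral_insert[symmetric]) (use W_meas[of m] Suc.prems T in auto)
  also have "\<dots> \<le> 1"
    using Suc.IH Suc.prems T unfolding W_def c_def by simp
  finally show ?case using T unfolding W_def c_def by simp
qed

text \<open>Chernoff's method with a random sample size. Prescribing the value \<open>k\<close> of
  the sample count makes the compensator the constant \<open>c * k\<close> on the event, so Markov's
  inequality applies to the compensated exponential \<open>W\<close>.\<close>

lemma adaptive_Hoeffding_upper:
  fixes f :: "'a \<Rightarrow> real" and A :: "nat \<Rightarrow> (nat \<Rightarrow> 'a) \<Rightarrow> bool"
  assumes D: "prob_space D" and f[measurable]: "f \<in> borel_measurable D"
    and mean: "(\<integral>y. f y \<partial>D) = 0" and range: "AE y in D. f y \<in> {a..b}" and "a < b"
    and A: "\<And>t. t \<in> {1..T} \<Longrightarrow> Measurable.pred (\<Pi>\<^sub>M t\<in>{1..T}. D) (A t)"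
    and pred: "\<And>u t z y. u \<in> {1..t} \<Longrightarrow> t \<le> T \<Longrightarrow> A u (z(t := y)) = A u z"
    and "m \<le> T" "k > 0" "\<epsilon> > 0"
  shows "measure (\<Pi>\<^sub>M t\<in>{1..T}. D) {z \<in> space (\<Pi>\<^sub>M t\<in>{1..T}. D).
            (\<Sum>u=1..m. of_bool (A u z)) = k \<and> \<epsilon> \<le> (\<Sum>u=1..m. if A u z then f (z u) else 0)}
         \<le> exp (- (2 * \<epsilon>\<^sup>2 / (k * (b - a)\<^sup>2)))"
proof -
  let ?M = "\<Pi>\<^sub>M t\<in>{1..T}. D"
  let ?E = "{z \<in> space ?M. (\<Sum>u=1..m. of_bool (A u z)) = k \<and> \<epsilon> \<le> (\<Sum>u=1..m. if A u z then f (z u) else 0)}"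
  \<comment> \<open>This \<open>s\<close> maximizes the exponent
    \<open>s * \<epsilon> - s\<^sup>2 * (b - a)\<^sup>2 * k / 8\<close>.\<close>
  define s where "s = 4 * \<epsilon> / (k * (b - a)\<^sup>2)"
  define c where "c = s\<^sup>2 * (b - a)\<^sup>2 / 8"
  define W where "W z = exp (\<Sum>u=1..m. if A u z then s * f (z u) - c else 0)" for z
  interpret M: prob_space ?M by (intro prob_space_PiM D)
  have s: "s > 0" using assms by (simp add: s_def)
  have um: "u \<in> {1..T}" if "u \<in> {1..m}" for u using that \<open>m \<le> T\<close> by auto
  have [measurable]: "Measurable.pred ?M (A u)" if "u \<in> {1..m}" for u
    using A um[OF that] .
  have [measurable]: "(\<lambda>z. f (z u)) \<in> borel_measurable ?M" if "u \<in> {1..m}" for u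
    using measurable_PiM_component_rev[OF um[OF that], of f "\<lambda>_. D" borel, OF f] .
  have W_meas[measurable]: "W \<in> borel_measurable ?M" unfolding W_def by measurable
  have E[measurable]: "?E \<in> sets ?M" by measurable
  have exponent: "s * \<epsilon> - c * k = 2 * \<epsilon>\<^sup>2 / (k * (b - a)\<^sup>2)"
  proof -
    have "4 * \<epsilon> / (k * d) * \<epsilon> - (4 * \<epsilon> / (k * d))\<^sup>2 * d / 8 * k = 2 * \<epsilon>\<^sup>2 / (k * d)"
      if "d \<noteq> 0" for d
      using that \<open>k > 0\<close> by (simp add: field_simps power2_eq_square)
    from this[of "(b - a)\<^sup>2"] show ?thesis using \<open>a < b\<close> by (simp add: s_def c_def)
  qed
  have low: "exp (2 * \<epsilon>\<^sup>2 / (k * (b - a)\<^sup>2)) \<le> W z" if "z \<in> ?E" for z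
  proof -
    have "(\<Sum>u=1..m. if A u z then s * f (z u) - c else 0)
        = (\<Sum>u=1..m. s * (if A u z then f (z u) else 0) - c * of_bool (A u z))"
      by (intro sum.cong) auto
    also have "\<dots> = s * (\<Sum>u=1..m. if A u z then f (z u) else 0) - c * (\<Sum>u=1..m. of_bool (A u z))"
      by (simp only: sum_subtractf sum_distrib_left)
    also have "\<dots> \<ge> s * \<epsilon> - c * k"
      using that s by (auto intro!: mult_left_mono)
    finally show ?thesis unfolding W_def exponent by simp
  qed
  \<comment> \<open>Markov's inequality for \<open>W\<close>.\<close>
  have "ennreal (exp (2 * \<epsilon>\<^sup>2 / (k * (b - a)\<^sup>2))) * emeasure ?M ?E
      = (\<integral>\<^sup>+z. ennreal (exp (2 * \<epsilon>\<^sup>2 / (k * (b - a)\<^sup>2))) * indicator ?E z \<partial>?M)"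
    by (rule nn_integral_cmult_indicator[symmetric, OF E])
  also have "\<dots> \<le> (\<integral>\<^sup>+z. W z \<partial>?M)"
    by (intro nn_integral_mono) (use low in \<open>auto split: split_indicator intro!: ennreal_leI\<close>)
  also have "\<dots> \<le> 1"
    unfolding W_def c_def by (rule adaptive_exponential_moment[OF D f mean range A pred s \<open>m \<le> T\<close>])
  finally have "exp (2 * \<epsilon>\<^sup>2 / (k * (b - a)\<^sup>2)) * measure ?M ?E \<le> 1"
    unfolding M.emeasure_eq_measure by (subst (asm) ennreal_mult[symmetric]) auto
  then show ?thesis by (simp add: exp_minus field_simps)
qed

section \<open>Histories and play counts along a run\<close>

lemma length_run [simp]: "length (run \<pi> z t) = t"
  by (induction t) (simp_all add: Let_def)

lemma run_fun_upd: "s < t \<Longrightarrow> run \<pi> (z(t := y)) s = run \<pi> z s"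
  by (induction s) (simp_all add: Let_def)

text \<open>Predictability: the arm of round \<open>u\<close> is chosen from the outcomes of rounds
  before \<open>u\<close>, so even the arm of round \<open>t\<close> itself ignores outcome
  \<open>t\<close>. This discharges the \<open>pred\<close> hypotheses above.\<close>

lemma played_fun_upd: "u \<in> {1..t} \<Longrightarrow> played \<pi> (z(t := y)) u = played \<pi> z u"
  by (auto simp: played_def run_fun_upd)

lemma played_Suc: "played \<pi> z (Suc t) = \<pi> (run \<pi> z t)"
  by (simp add: played_def)

text \<open>Together with \<open>sum_observations_run\<close> this turns list statistics of the
  history into the indicator sums of \<open>adaptive_Hoeffding_upper\<close>.\<close>

lemma play_count_run:
  "play_count (run \<pi> z m) i = (\<Sum>u=1..m. of_bool (played \<pi> z u = i))"
  by (induction m) (simp_all add: play_count_def observations_def played_Suc Let_def del: sum_of_bool_eq)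

lemma sum_observations_run:
  "(\<Sum>y\<leftarrow>observations (run \<pi> z m) i. g y)
     = (\<Sum>u=1..m. if played \<pi> z u = i then g (fst (z u) i, snd (z u) i) else 0)"
  by (induction m) (simp_all add: observations_def played_Suc Let_def)

text \<open>An arm played \<open>N\<close> times contributes \<open>1 / sqrt k\<close> for
  \<open>k = 0, ..., N - 1\<close>, at most \<open>2 * sqrt (N - 1)\<close> in total. Cauchy-Schwarz
  over the \<open>n\<close> arms, whose counts add up to \<open>m\<close>, gives the bound.\<close>

lemma sum_inverse_sqrt_play_count:
  assumes "\<And>t. t \<in> {1..m} \<Longrightarrow> played \<pi> z t \<in> {1..n}"
  shows "(\<Sum>t=1..m. 1 / sqrt (real (play_count (run \<pi> z (t - 1)) (played \<pi> z t))))
         \<le> 2 * sqrt (real n * real m)"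
proof -
  define N where "N t i = play_count (run \<pi> z t) i" for t i
  have N_Suc: "N (Suc t) i = N t i + of_bool (played \<pi> z (Suc t) = i)" for t i
    unfolding N_def play_count_run by simp
  have "(\<Sum>t=1..j. 1 / sqrt (real (N (t - 1) (played \<pi> z t))))
        \<le> (\<Sum>i=1..n. 2 * sqrt (real (N j i - 1)))" if "j \<le> m" for j
    using that
  proof (induction j)
    case 0
    show ?case by (simp add: sum_nonneg)
  next
    case (Suc j)
    let ?i = "played \<pi> z (Suc j)"
    have i: "?i \<in> {1..n}" using assms Suc.prems by auto
    \<comment> \<open>Telescoping form of
      \<open>1 / sqrt k \<le> 2 * (sqrt k - sqrt (k - 1))\<close>. At the first play,
      \<open>k = 0\<close>, division by zero and truncated subtraction make every term 0.\<close>
    have step: "1 / sqrt (real k) + 2 * sqrt (real (k - 1)) \<le> 2 * sqrt (real k)" for k :: nat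
    proof (cases "k = 0")
      case False
      define a where "a = sqrt (real k)"
      define b where "b = sqrt (real (k - 1))"
      have a: "a > 0" "b \<ge> 0" "b * b = a * a - 1" using False by (auto simp: a_def b_def)
      have "0 \<le> (a - b) * (a - b)" by simp
      then have "1 + 2 * (a * b) \<le> 2 * (a * a)" using a by (simp add: algebra_simps)
      then show ?thesis using a(1) unfolding a_def[symmetric] b_def[symmetric] by (simp add: field_simps)
    qed simp
    have "(\<Sum>t=1..Suc j. 1 / sqrt (real (N (t - 1) (played \<pi> z t))))
        \<le> (\<Sum>i=1..n. 2 * sqrt (real (N j i - 1))) + 1 / sqrt (real (N j ?i))"
      using Suc by simp
    also have "\<dots> = (\<Sum>i\<in>{1..n} - {?i}. 2 * sqrt (real (N j i - 1)))
        + (1 / sqrt (real (N j ?i)) + 2 * sqrt (real (N j ?i - 1)))"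
      using i by (subst sum.remove[of _ ?i]) auto
    also have "\<dots> \<le> (\<Sum>i\<in>{1..n} - {?i}. 2 * sqrt (real (N (Suc j) i - 1)))
        + 2 * sqrt (real (N (Suc j) ?i - 1))"
      using step[of "N j ?i"] by (intro add_mono sum_mono) (auto simp: N_Suc)
    also have "\<dots> = (\<Sum>i=1..n. 2 * sqrt (real (N (Suc j) i - 1)))"
      using i by (subst sum.remove[of "{1..n}" ?i]) auto
    finally show ?case .
  qed
  from this[of m] have "(\<Sum>t=1..m. 1 / sqrt (real (N (t - 1) (played \<pi> z t))))
        \<le> (\<Sum>i=1..n. 2 * sqrt (real (N m i - 1)))" by simp
  also have "\<dots> \<le> 2 * (\<Sum>i=1..n. 1 * sqrt (real (N m i)))"
    by (auto simp: sum_distrib_left intro!: sum_mono)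
  also have "(\<Sum>i=1..n. 1 * sqrt (real (N m i))) \<le> sqrt (real n * (\<Sum>i=1..n. real (N m i)))"
  proof -
    have "(\<Sum>i=1..n. 1 * sqrt (real (N m i)))\<^sup>2 \<le> (\<Sum>i=1..n. 1\<^sup>2) * (\<Sum>i=1..n. (sqrt (real (N m i)))\<^sup>2)"
      by (rule Cauchy_Schwarz_ineq_sum)
    then show ?thesis by (intro real_le_rsqrt) simp
  qed
  \<comment> \<open>Swapping the sums counts by rounds instead of arms: each of the \<open>m\<close>
    rounds is one play of exactly one arm.\<close>
  also have "(\<Sum>i=1..n. real (N m i)) = real (\<Sum>u=1..m. \<Sum>i=1..n. of_bool (played \<pi> z u = i))"
    unfolding N_def play_count_run by (subst sum.swap) (simp only: of_nat_sum)
  also have "(\<Sum>u=1..m. \<Sum>i=1..n. of_bool (played \<pi> z u = i)) = (\<Sum>u=1..m. 1::nat)"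
  proof (rule sum.cong)
    fix u assume "u \<in> {1..m}"
    then have "played \<pi> z u \<in> {1..n}" by (rule assms)
    then show "(\<Sum>i=1..n. of_bool (played \<pi> z u = i)) = (1::nat)"
      by (simp add: of_bool_def)
  qed simp
  finally show ?thesis by (simp add: N_def)
qed

section \<open>One instance: means, ranges and weak duality\<close>

text \<open>The horizon is fixed here, and \<open>n \<le> T\<close> is the non-asymptotic trace of
  \<open>n = o(T)\<close>.\<close>

locale aci_run =
  fixes n T imin imax :: nat and Cmax \<phi> :: real and D :: "outcome measure" and \<pi> :: policy
  assumes n2: "2 \<le> n" and nT: "n \<le> T" and Cmax: "1 \<le> Cmax" and phi: "0 < \<phi>" "\<phi> < 1"
    and inst: "bandit_instance n imin imax Cmax D"
    and alg: "primal_dual_ACI n T imin imax Cmax \<phi> (Cmax / (1 - \<phi>)) (1 / sqrt (real T)) \<pi>"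
    and meas: "measurable_policy T D \<pi>"
begin

definition \<Lambda> where "\<Lambda> = Cmax / (1 - \<phi>)"
definition \<eta> where "\<eta> = 1 / sqrt (real T)"
abbreviation arm where "arm z t \<equiv> played \<pi> z t"
definition lam where "lam z t = dual n \<phi> \<eta> (run \<pi> z (t - 1))"
abbreviation p where "p i \<equiv> mean_reward D i"
abbreviation w where "w i \<equiv> mean_cost D i"
abbreviation Cstar where "Cstar \<equiv> optimal_cost n \<phi> D"

sublocale D: prob_space D
  using inst by (simp add: bandit_instance_def)

sublocale M: prob_space "draws T D"
  by (intro prob_space_PiM D.prob_space_axioms)

lemma T_pos: "0 < T" and Lam_ge: "Cmax \<le> \<Lambda>" and eta_pos: "0 < \<eta>"
  and arms: "imin \<in> {1..n}" "imax \<in> {1..n}" "imin \<noteq> imax"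
proof -
  show "0 < T" using n2 nT by simp
  then show "0 < \<eta>" by (simp add: \<eta>_def)
  have "Cmax * (1 - \<phi>) \<le> Cmax" using Cmax phi by (simp add: mult_left_le)
  then show "Cmax \<le> \<Lambda>" using phi by (simp add: \<Lambda>_def pos_le_divide_eq)
qed (use inst in \<open>auto simp: bandit_instance_def\<close>)

lemma Lam_pos: "0 < \<Lambda>" using Lam_ge Cmax by simp

lemma outcome_measurable:
  assumes "i \<in> {1..n}"
  shows "(\<lambda>y. fst y i) \<in> borel_measurable D" "(\<lambda>y. snd y i) \<in> borel_measurable D"
proof -
  have [measurable_cong]: "sets D = sets ((\<Pi>\<^sub>M i\<in>{1..n}. borel) \<Otimes>\<^sub>M (\<Pi>\<^sub>M i\<in>{1..n}. borel))"
    using inst by (simp add: bandit_instance_def)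
  show "(\<lambda>y. fst y i) \<in> borel_measurable D" "(\<lambda>y. snd y i) \<in> borel_measurable D"
    using assms by measurable
qed

lemma outcome_range:
  "AE y in D. \<forall>i\<in>{1..n}. fst y i \<in> {0, 1} \<and> snd y i \<in> {0..Cmax}"
  using inst by (simp add: bandit_instance_def)

lemma
  assumes "i \<in> {1..n}"
  shows integrable_reward: "integrable D (\<lambda>y. fst y i)"
    and integrable_cost: "integrable D (\<lambda>y. snd y i)"
proof -
  show "integrable D (\<lambda>y. fst y i)"
  proof (rule D.integrable_const_bound)
    show "AE y in D. norm (fst y i) \<le> 1"
      using outcome_range by eventually_elim (use assms in force)
  qed (use outcome_measurable assms in auto)
  show "integrable D (\<lambda>y. snd y i)"
  proof (rule D.integrable_const_bound)
    show "AE y in D. norm (snd y i) \<le> Cmax"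
      using outcome_range by eventually_elim (use assms in force)
  qed (use outcome_measurable assms in auto)
qed

lemma boundary_means: "p imax = 1" "w imax = Cmax" "p imin = 0" "w imin = 0"
proof -
  have b: "AE z in D. fst z imax = 1 \<and> snd z imax = Cmax \<and> fst z imin = 0 \<and> snd z imin = 0"
    using inst by (simp add: bandit_instance_def)
  have "p imax = (\<integral>y. 1 \<partial>D)" "w imax = (\<integral>y. Cmax \<partial>D)" "p imin = (\<integral>y. 0 \<partial>D)" "w imin = (\<integral>y. 0 \<partial>D)"
    unfolding mean_reward_def mean_cost_def
    by (intro integral_cong_AE outcome_measurable arms borel_measurable_const eventually_mono[OF b]; simp)+
  then show "p imax = 1" "w imax = Cmax" "p imin = 0" "w imin = 0" by (simp_all add: D.prob_space)
qed

lemma means_range: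
  assumes "i \<in> {1..n}"
  shows "0 \<le> p i" "p i \<le> 1" "0 \<le> w i" "w i \<le> Cmax"
proof -
  have "(i \<in> {imin, imax}) \<or> (p i \<in> {0<..<1} \<and> w i \<in> {0<..<Cmax})"
    using inst assms by (auto simp: bandit_instance_def)
  then show "0 \<le> p i" "p i \<le> 1" "0 \<le> w i" "w i \<le> Cmax"
    using boundary_means Cmax by auto
qed

text \<open>Average the hypothesis on \<open>v\<close> with the weights of a feasible
  \<open>x\<close> and use \<open>l\<close> times its success constraint.\<close>

lemma weak_duality:
  assumes "0 \<le> l" and v: "\<And>i. i \<in> {1..n} \<Longrightarrow> v \<le> w i - l * p i"
  shows "v + l * \<phi> \<le> Cstar"
  unfolding optimal_cost_def
proof (rule cINF_greatest)
  \<comment> \<open>The unit vector of \<open>imax\<close> is feasible; an infimum over the empty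
    set would be unspecified.\<close>
  have "(\<lambda>i. of_bool (i = imax)) \<in> {x \<in> prob_simplex n. (\<Sum>i=1..n. x i * p i) \<ge> \<phi>}"
    using arms phi boundary_means
    by (auto simp: prob_simplex_def of_bool_def if_distrib[of "\<lambda>x. x * _"] cong: if_cong)
  then show "{x \<in> prob_simplex n. (\<Sum>i=1..n. x i * p i) \<ge> \<phi>} \<noteq> {}" by blast
next
  fix x assume "x \<in> {x \<in> prob_simplex n. (\<Sum>i=1..n. x i * p i) \<ge> \<phi>}"
  then have x: "\<And>i. i \<in> {1..n} \<Longrightarrow> 0 \<le> x i" "(\<Sum>i=1..n. x i) = 1" "\<phi> \<le> (\<Sum>i=1..n. x i * p i)"
    by (auto simp: prob_simplex_def)
  have "v + l * \<phi> \<le> (\<Sum>i=1..n. x i) * v + l * (\<Sum>i=1..n. x i * p i)"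
    using x assms by (simp add: mult_left_mono)
  also have "\<dots> = (\<Sum>i=1..n. x i * v + l * (x i * p i))"
    by (simp only: sum_distrib_left sum_distrib_right sum.distrib)
  also have "\<dots> \<le> (\<Sum>i=1..n. x i * (w i - l * p i) + l * (x i * p i))"
    using x v by (intro sum_mono add_right_mono mult_left_mono) auto
  also have "\<dots> = (\<Sum>i=1..n. x i * w i)" by (simp add: algebra_simps)
  finally show "v + l * \<phi> \<le> (\<Sum>i=1..n. x i * w i)" .
qed

lemma Cstar_nonneg: "0 \<le> Cstar"
  using weak_duality[of 0 0] means_range by simp

section \<open>Rules of the algorithm and the dual variable\<close>

lemma arm_cases:
  assumes "t \<in> {1..T}"
  obtains (init) "t < n - 1" "arm z t \<in> {1..n} - {imin, imax} - fst ` set (run \<pi> z (t - 1))"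
  | (high) "n - 1 \<le> t" "\<Lambda> \<le> lam z t" "arm z t = imax"
  | (low) "n - 1 \<le> t" "lam z t \<le> 0" "arm z t = imin"
  | (argmin) "n - 1 \<le> t" "0 < lam z t" "lam z t < \<Lambda>" "arm z t \<in> {1..n}"
    "\<And>i. i \<in> {1..n} \<Longrightarrow>
      cost_lcb n T imin imax Cmax (run \<pi> z (t - 1)) (arm z t) - lam z t * reward_ucb n T imin imax (run \<pi> z (t - 1)) (arm z t)
      \<le> cost_lcb n T imin imax Cmax (run \<pi> z (t - 1)) i - lam z t * reward_ucb n T imin imax (run \<pi> z (t - 1)) i"
proof -
  let ?h = "run \<pi> z (t - 1)"
  have "length ?h < T" using assms by auto
  from alg[unfolded primal_dual_ACI_def, rule_format, OF this]
  have a: "if length ?h < n - 2 then \<pi> ?h \<in> {1..n} - {imin, imax} - fst ` set ?h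
         else if dual n \<phi> \<eta> ?h \<ge> \<Lambda> then \<pi> ?h = imax
         else if dual n \<phi> \<eta> ?h \<le> 0 then \<pi> ?h = imin
         else is_arg_min
                (\<lambda>i. cost_lcb n T imin imax Cmax ?h i - dual n \<phi> \<eta> ?h * reward_ucb n T imin imax ?h i)
                (\<lambda>i. i \<in> {1..n}) (\<pi> ?h)"
    unfolding \<Lambda>_def \<eta>_def .
  \<comment> \<open>Round \<open>t\<close> sees a history of length \<open>t - 1\<close>, so
    initialization consists of the rounds \<open>1, ..., n - 2\<close>.\<close>
  have len: "length ?h < n - 2 \<longleftrightarrow> t < n - 1" using assms by auto
  show thesis
  proof (cases "t < n - 1")
    case True
    then show thesis using a len init by (simp add: played_def)
  next
    case F: False
    show thesis
    proof (cases "lam z t \<ge> \<Lambda>")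
      case True
      then show thesis using a len high F by (simp add: played_def lam_def)
    next
      case F1: False
      show thesis
      proof (cases "lam z t \<le> 0")
        case True
        then show thesis using a len low F F1 by (simp add: played_def lam_def)
      next
        case F2: False
        have "is_arg_min
                (\<lambda>i. cost_lcb n T imin imax Cmax ?h i - lam z t * reward_ucb n T imin imax ?h i)
                (\<lambda>i. i \<in> {1..n}) (arm z t)"
          using a len F F1 F2 unfolding lam_def played_def by (simp only: if_False if_True)
        then show thesis using argmin F F1 F2 by (auto simp: is_arg_min_linorder)
      qed
    qed
  qed
qed

lemma arm_in: "t \<in> {1..T} \<Longrightarrow> arm z t \<in> {1..n}"
  by (cases rule: arm_cases[of t z]) (use arms in auto)

text \<open>Initialization plays \<open>n - 2\<close> distinct non-boundary arms, and there are only
  that many. Hence no radius used by the arg min rule for such an arm divides by zero.\<close>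

lemma play_count_pos:
  assumes "n - 1 \<le> t" "t \<le> T" "i \<in> {1..n} - {imin, imax}"
  shows "0 < play_count (run \<pi> z (t - 1)) i"
proof -
  let ?S = "\<lambda>m. fst ` set (run \<pi> z m)"
  have "?S m \<subseteq> {1..n} - {imin, imax} \<and> card (?S m) = m" if "m \<le> n - 2" for m
    using that
  proof (induction m)
    case (Suc m)
    have "Suc m \<in> {1..T}" using Suc.prems nT by auto
    then have "arm z (Suc m) \<in> {1..n} - {imin, imax} - ?S m"
      by (cases rule: arm_cases[of _ z]) (use Suc.prems in auto)
    moreover have "?S (Suc m) = insert (arm z (Suc m)) (?S m)"
      by (simp add: Let_def played_Suc)
    ultimately show ?case using Suc by simp
  qed simp
  from this[of "n - 2"] have S: "?S (n - 2) \<subseteq> {1..n} - {imin, imax}" "card (?S (n - 2)) = n - 2"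
    by auto
  have "card ({1..n} - {imin, imax}) = n - 2"
    using arms by (subst card_Diff_subset) auto
  then have "?S (n - 2) = {1..n} - {imin, imax}"
    using S by (intro card_subset_eq) auto
  \<comment> \<open>Histories only grow, so arms seen after \<open>n - 2\<close> rounds stay
    seen.\<close>
  moreover have "?S m \<subseteq> ?S (m + k)" for m k
    by (induction k) (auto simp: Let_def)
  from this[of "n - 2" "t - 1 - (n - 2)"] have "?S (n - 2) \<subseteq> ?S (t - 1)"
    using assms n2 by simp
  ultimately have "i \<in> ?S (t - 1)" using assms by blast
  then show ?thesis
    by (auto simp: play_count_def observations_def filter_empty_conv)
qed

text \<open>Before round \<open>t\<close> the history has at most \<open>n - 2\<close> entries, all
  of which \<open>dual\<close> drops. Round \<open>n - 1\<close> is thus the first one that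
  updates.\<close>

lemma lam_init: "t \<le> n - 1 \<Longrightarrow> lam z t = 0"
  by (simp add: lam_def dual_def)

lemma lam_Suc:
  assumes "n - 1 \<le> t"
  shows "lam z (Suc t) = lam z t + \<eta> * (\<phi> - fst (z t) (arm z t))"
proof -
  obtain s where t: "t = Suc s" using assms n2 by (cases t) auto
  have "n - 2 \<le> s" using assms t by simp
  then show ?thesis by (simp add: lam_def dual_def t Let_def played_Suc)
qed

lemma lam_fun_upd: "1 \<le> t \<Longrightarrow> lam (z(t := y)) t = lam z t"
  by (simp add: lam_def run_fun_upd)

section \<open>Measurability and almost sure ranges\<close>

lemma arm_measurable: "t \<in> {1..T} \<Longrightarrow> (\<lambda>z. arm z t) \<in> draws T D \<rightarrow>\<^sub>M count_space UNIV"
  using meas by (simp add: measurable_policy_def)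

lemma draw_measurable:
  assumes "t \<in> {1..T}" "i \<in> {1..n}"
  shows "(\<lambda>z. fst (z t) i) \<in> borel_measurable (draws T D)"
    and "(\<lambda>z. snd (z t) i) \<in> borel_measurable (draws T D)"
  using measurable_PiM_component_rev[OF assms(1), of "\<lambda>y. fst y i" "\<lambda>_. D" borel]
    measurable_PiM_component_rev[OF assms(1), of "\<lambda>y. snd y i" "\<lambda>_. D" borel]
    outcome_measurable[OF assms(2)] by blast+

text \<open>Evaluation at the random arm becomes a finite sum over fixed arms, to which
  measurability and independence arguments apply.\<close>

lemma sum_arm: "t \<in> {1..T} \<Longrightarrow> (\<Sum>i=1..n. of_bool (arm z t = i) * (f i :: real)) = f (arm z t)"
  using arm_in[of t z] by (simp add: of_bool_def if_distrib[of "\<lambda>x. x * _"] cong: if_cong)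

lemma reward_measurable:
  assumes "t \<in> {1..T}"
  shows "(\<lambda>z. fst (z t) (arm z t)) \<in> borel_measurable (draws T D)"
proof -
  have "(\<lambda>z. \<Sum>i=1..n. of_bool (arm z t = i) * fst (z t) i) \<in> borel_measurable (draws T D)"
  proof (rule borel_measurable_sum)
    fix i assume "i \<in> {1..n}"
    note [measurable] = draw_measurable[OF assms this] arm_measurable[OF assms]
    show "(\<lambda>z. of_bool (arm z t = i) * fst (z t) i) \<in> borel_measurable (draws T D)"
      by measurable
  qed
  then show ?thesis by (simp only: sum_arm[OF assms])
qed

text \<open>Induction along the recursion of \<open>lam\<close> spares a measurable structure on
  histories.\<close>

lemma lam_measurable: "t \<le> Suc T \<Longrightarrow> (\<lambda>z. lam z t) \<in> borel_measurable (draws T D)"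
proof (induction t)
  case (Suc t)
  show ?case
  proof (cases "n - 1 \<le> t")
    case True
    then have "t \<in> {1..T}" using n2 Suc.prems by auto
    note reward_measurable[OF this]
    then show ?thesis unfolding lam_Suc[OF True]
      by (intro borel_measurable_add borel_measurable_times borel_measurable_diff borel_measurable_const Suc.IH)
        (use Suc.prems in auto)
  qed (simp add: lam_init)
qed (simp add: lam_init)

lemma draws_range:
  "AE z in draws T D. \<forall>t\<in>{1..T}. \<forall>i\<in>{1..n}. fst (z t) i \<in> {0, 1} \<and> snd (z t) i \<in> {0..Cmax}"
  by (intro eventually_ball_finite[OF finite_atLeastAtMost] ballI AE_PiM_component[where P = "\<lambda>y. \<forall>i\<in>{1..n}. fst y i \<in> {0, 1} \<and> snd y i \<in> {0..Cmax}"]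
      D.prob_space_axioms outcome_range)

lemma reward_range:
  assumes "\<forall>t\<in>{1..T}. \<forall>i\<in>{1..n}. fst (z t) i \<in> {0, 1} \<and> snd (z t) i \<in> {0..Cmax}" "t \<in> {1..T}"
  shows "\<bar>\<phi> - fst (z t) (arm z t)\<bar> \<le> 1"
proof -
  have "fst (z t) (arm z t) \<in> {0, 1}" using assms arm_in by blast
  then show ?thesis using phi by auto
qed

text \<open>Each update moves the dual variable by at most \<open>\<eta>\<close>. This growing bound
  serves to make the noise terms integrable.\<close>

lemma lam_bound:
  assumes "\<forall>t\<in>{1..T}. \<forall>i\<in>{1..n}. fst (z t) i \<in> {0, 1} \<and> snd (z t) i \<in> {0..Cmax}"
  shows "t \<le> Suc T \<Longrightarrow> \<bar>lam z t\<bar> \<le> \<eta> * real t"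
proof (induction t)
  case (Suc t)
  show ?case
  proof (cases "n - 1 \<le> t")
    case True
    then have t: "t \<in> {1..T}" using n2 Suc.prems by auto
    have "\<bar>\<eta> * (\<phi> - fst (z t) (arm z t))\<bar> \<le> \<eta> * 1"
      using reward_range[OF assms t] eta_pos unfolding abs_mult by (intro mult_mono) auto
    then show ?thesis using Suc lam_Suc[OF True, of z] by (simp add: distrib_left)
  qed (use eta_pos in \<open>simp add: lam_init\<close>)
qed (simp add: lam_init)

text \<open>The interval is written as \<open>{a..a + c}\<close> with its length visible, the form
  that \<open>prob_deviation_event\<close> takes.\<close>

lemma centered_reward:
  assumes i: "i \<in> {1..n}"
  shows "(\<integral>y. fst y i - p i \<partial>D) = 0" "AE y in D. fst y i - p i \<in> {- p i..- p i + 1}"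
proof -
  show "(\<integral>y. fst y i - p i \<partial>D) = 0"
    using integrable_reward[OF i] by (simp add: mean_reward_def D.prob_space)
  show "AE y in D. fst y i - p i \<in> {- p i..- p i + 1}"
    using outcome_range
  proof eventually_elim
    case (elim y)
    then have "fst y i \<in> {0, 1}" using i by blast
    then show ?case by auto
  qed
qed

lemma centered_cost:
  assumes i: "i \<in> {1..n}"
  shows "(\<integral>y. snd y i - w i \<partial>D) = 0" "AE y in D. snd y i - w i \<in> {- w i..- w i + Cmax}"
proof -
  show "(\<integral>y. snd y i - w i \<partial>D) = 0"
    using integrable_cost[OF i] by (simp add: mean_cost_def D.prob_space)
  show "AE y in D. snd y i - w i \<in> {- w i..- w i + Cmax}"
    using outcome_range by eventually_elim (use i in force)
qed

section \<open>Mean-zero noise and the drift of the dual variable\<close>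

text \<open>The martingale difference left when realized cost and reward replace their means in the
  Lagrangian. It is split by arms so that each summand is made of predictable factors times centered
  functions of outcome \<open>t\<close>.\<close>

definition noise where
  "noise z t = (\<Sum>i=1..n. of_bool (arm z t = i) * (snd (z t) i - w i)
                 - (of_bool (arm z t = i) * lam z t) * (fst (z t) i - p i))"

lemma noise_eq:
  assumes "t \<in> {1..T}"
  shows "noise z t = (snd (z t) (arm z t) - w (arm z t))
           - lam z t * (fst (z t) (arm z t) - p (arm z t))"
proof -
  have "noise z t = (\<Sum>i=1..n. of_bool (arm z t = i) * ((snd (z t) i - w i) - lam z t * (fst (z t) i - p i)))"
    unfolding noise_def by (intro sum.cong) (auto simp: algebra_simps)
  then show ?thesis using sum_arm[OF assms] by simp
qed

text \<open>For a fixed arm, the indicator of its being played and \<open>lam z t\<close> ignore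
  outcome \<open>t\<close>, so \<open>predictable_mean_zero\<close> applies to the cost part and to
  the reward part.\<close>

lemma noise_mean_zero:
  assumes t: "t \<in> {1..T}"
  shows "integrable (draws T D) (\<lambda>z. noise z t)" "(\<integral>z. noise z t \<partial>draws T D) = 0"
proof -
  have "integrable (draws T D) (\<lambda>z. of_bool (arm z t = i) * (snd (z t) i - w i)
            - (of_bool (arm z t = i) * lam z t) * (fst (z t) i - p i))
      \<and> (\<integral>z. of_bool (arm z t = i) * (snd (z t) i - w i)
            - (of_bool (arm z t = i) * lam z t) * (fst (z t) i - p i) \<partial>draws T D) = 0"
    if i: "i \<in> {1..n}" for i
  proof -
    have "t \<le> Suc T" using t by simp
    note [measurable] = lam_measurable[OF this] arm_measurable[OF t] outcome_measurable[OF i]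
    have g1: "(\<lambda>z. of_bool (arm z t = i) :: real) \<in> borel_measurable (draws T D)"
      and g2: "(\<lambda>z. of_bool (arm z t = i) * lam z t) \<in> borel_measurable (draws T D)"
      by measurable
    have pred: "arm (z(t := y)) t = arm z t" "lam (z(t := y)) t = lam z t" for z y
      using t by (simp_all add: played_fun_upd lam_fun_upd)
    have c: "AE y in D. \<bar>snd y i - w i\<bar> \<le> Cmax" and r: "AE y in D. \<bar>fst y i - p i\<bar> \<le> 1"
      using centered_cost(2)[OF i] centered_reward(2)[OF i]
      by (eventually_elim, use means_range[OF i] in \<open>simp add: abs_le_iff\<close>)+
    have b2: "AE z in draws T D. \<bar>of_bool (arm z t = i) * lam z t\<bar> \<le> \<eta> * real t"
      using draws_range by eventually_elim (use lam_bound \<open>t \<le> Suc T\<close> eta_pos in \<open>auto simp: of_bool_def\<close>)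
    have b1: "AE z in draws T D. \<bar>of_bool (arm z t = i) :: real\<bar> \<le> 1" by simp
    have f: "(\<lambda>y. snd y i - w i) \<in> borel_measurable D" "(\<lambda>y. fst y i - p i) \<in> borel_measurable D"
      by measurable
    note m1 = predictable_mean_zero[OF D.prob_space_axioms t g1 _ f(1) centered_cost(1)[OF i] b1 c]
    note m2 = predictable_mean_zero[OF D.prob_space_axioms t g2 _ f(2) centered_reward(1)[OF i] b2 r]
    show ?thesis using m1 m2 pred by simp
  qed
  then show "integrable (draws T D) (\<lambda>z. noise z t)" "(\<integral>z. noise z t \<partial>draws T D) = 0"
    unfolding noise_def by (auto simp: Bochner_Integration.integral_sum)
qed

text \<open>Online gradient descent with the square of the dual variable as potential: expand the
  square of the update and telescope. In the initialization phase both sides of a step vanish up to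
  the nonnegative slack \<open>\<eta>\<^sup>2\<close>.\<close>

lemma dual_drift:
  assumes z: "\<forall>t\<in>{1..T}. \<forall>i\<in>{1..n}. fst (z t) i \<in> {0, 1} \<and> snd (z t) i \<in> {0..Cmax}"
  shows "(\<Sum>t=1..T. lam z t * (fst (z t) (arm z t) - \<phi>)) \<le> sqrt (real T) / 2"
proof -
  have "2 * \<eta> * (\<Sum>t=1..m. lam z t * (fst (z t) (arm z t) - \<phi>)) \<le> real m * \<eta>\<^sup>2 - (lam z (Suc m))\<^sup>2"
    if "m \<le> T" for m
    using that
  proof (induction m)
    case 0
    then show ?case using n2 by (simp add: lam_init)
  next
    case (Suc m)
    let ?t = "Suc m"
    let ?d = "\<phi> - fst (z ?t) (arm z ?t)"
    have "2 * \<eta> * (lam z ?t * - ?d) \<le> \<eta>\<^sup>2 + (lam z ?t)\<^sup>2 - (lam z (Suc ?t))\<^sup>2"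
    proof (cases "n - 1 \<le> ?t")
      case True
      have "?d\<^sup>2 \<le> 1" using reward_range[OF z, of ?t] Suc.prems by (simp add: abs_square_le_1)
      then have "\<eta>\<^sup>2 * ?d\<^sup>2 \<le> \<eta>\<^sup>2" by (simp add: mult_left_le)
      then show ?thesis unfolding lam_Suc[OF True] by (simp add: power2_eq_square algebra_simps)
    next
      case False
      then show ?thesis by (simp add: lam_init)
    qed
    then show ?case using Suc by (simp add: algebra_simps)
  qed
  from this[of T] have "2 * \<eta> * (\<Sum>t=1..T. lam z t * (fst (z t) (arm z t) - \<phi>)) \<le> real T * \<eta>\<^sup>2 - (lam z (Suc T))\<^sup>2"
    by simp
  also have "\<dots> \<le> real T * \<eta>\<^sup>2" by simp
  \<comment> \<open>The step size \<open>1 / sqrt T\<close> makes the accumulated second-order terms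
    exactly 1; dividing by \<open>2 * \<eta>\<close> yields \<open>sqrt T / 2\<close>.\<close>
  also have "\<dots> = 1" using T_pos by (simp add: \<eta>_def power_divide)
  finally have "2 * \<eta> * (\<Sum>t=1..T. lam z t * (fst (z t) (arm z t) - \<phi>)) \<le> 1" .
  then show ?thesis using T_pos by (simp add: \<eta>_def field_simps)
qed

section \<open>Validity of the confidence intervals\<close>

definition rad where "rad k = sqrt (2 * ln (real n * real T) / k)"

text \<open>Fixing the random play count to \<open>k\<close> makes the radius deterministic. The
  threshold is \<open>c * rad k\<close> times \<open>k\<close>, as sums are compared instead of
  averages. Deviations are one-sided; the other side comes from the negated
  \<open>f\<close>.\<close>

definition deviation_event where
  "deviation_event c f i m k = {z \<in> space (draws T D). (\<Sum>u=1..m. of_bool (arm z u = i)) = k \<and>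
      c * (k * rad k) \<le> (\<Sum>u=1..m. if arm z u = i then f (z u) else 0)}"

lemma ln_pos: "0 < ln (real n * real T)"
proof -
  have "2 * 1 \<le> real n * real T" using n2 T_pos by (intro mult_mono) auto
  then show ?thesis by simp
qed

lemma deviation_event_measurable:
  assumes f: "f \<in> borel_measurable D" and "m \<le> T"
  shows "deviation_event c f i m k \<in> sets (draws T D)"
proof -
  have u: "u \<in> {1..T}" if "u \<in> {1..m}" for u using that \<open>m \<le> T\<close> by auto
  note [measurable] = arm_measurable[OF u] measurable_PiM_component_rev[OF u, of _ f "\<lambda>_. D" borel, OF _ f]
  show ?thesis unfolding deviation_event_def by measurable
qed

text \<open>For the threshold \<open>c * (k * rad k)\<close> and a range of length \<open>c\<close>,
  the Hoeffding exponent is \<open>4 * ln (n * T)\<close> for every \<open>k\<close>.\<close>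

lemma prob_deviation_event:
  assumes f: "f \<in> borel_measurable D" and m: "m \<le> T" and k: "0 < k"
    and mean: "(\<integral>y. f y \<partial>D) = 0" and range: "AE y in D. f y \<in> {a..a + c}" and c: "0 < c"
  shows "measure (draws T D) (deviation_event c f i m k) \<le> 1 / (real n * real T) ^ 4"
proof -
  let ?L = "ln (real n * real T)"
  have nT_pos: "0 < real n * real T" using n2 T_pos by simp
  have "measure (draws T D) (deviation_event c f i m k)
      \<le> exp (- (2 * (c * (k * rad k))\<^sup>2 / (k * (a + c - a)\<^sup>2)))"
    unfolding deviation_event_def
  proof (rule adaptive_Hoeffding_upper[OF D.prob_space_axioms f mean range])
    fix t assume "t \<in> {1..T}"
    note [measurable] = arm_measurable[OF this]
    show "Measurable.pred (draws T D) (\<lambda>z. arm z t = i)" by measurable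
  qed (use m k c ln_pos in \<open>auto simp: rad_def played_fun_upd\<close>)
  also have "2 * (c * (k * rad k))\<^sup>2 / (k * (a + c - a)\<^sup>2) = 4 * ?L"
    using k c ln_pos by (simp add: rad_def power_mult_distrib) (simp add: field_simps power2_eq_square)
  also have "exp (- (4 * ?L)) = 1 / exp ?L ^ 4"
    by (simp add: exp_minus exp_of_nat_mult[of 4 ?L, symmetric] inverse_eq_divide)
  also have "exp ?L = real n * real T" using nT_pos by simp
  finally show ?thesis .
qed

definition deviation_events where
  "deviation_events i m k =
     deviation_event 1 (\<lambda>y. fst y i - p i) i m k \<union> deviation_event 1 (\<lambda>y. p i - fst y i) i m k \<union>
     deviation_event Cmax (\<lambda>y. snd y i - w i) i m k \<union> deviation_event Cmax (\<lambda>y. w i - snd y i) i m k"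

text \<open>The history before a round has length \<open>m < T\<close>, and once an arm has been
  played its count lies in \<open>{1..T}\<close>. These triples therefore cover all intervals
  consulted after initialization.\<close>

definition bad where
  "bad = (\<Union>(i, m, k)\<in>({1..n} - {imin, imax}) \<times> {..<T} \<times> {1..T}. deviation_events i m (real k))"

lemma deviation_events_measurable:
  "i \<in> {1..n} \<Longrightarrow> m \<le> T \<Longrightarrow> deviation_events i m k \<in> sets (draws T D)"
  unfolding deviation_events_def
  by (intro sets.Un deviation_event_measurable borel_measurable_diff outcome_measurable borel_measurable_const)

lemma bad_measurable: "bad \<in> sets (draws T D)"
  unfolding bad_def by (intro sets.finite_UN) (auto simp del: One_nat_def intro!: deviation_events_measurable)

lemma prob_deviation_events:
  assumes i: "i \<in> {1..n}" and m: "m \<le> T" and k: "0 < k"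
  shows "measure (draws T D) (deviation_events i m k) \<le> 4 / (real n * real T) ^ 4"
proof -
  have meas: "(\<lambda>y. fst y i - p i) \<in> borel_measurable D" "(\<lambda>y. p i - fst y i) \<in> borel_measurable D"
    "(\<lambda>y. snd y i - w i) \<in> borel_measurable D" "(\<lambda>y. w i - snd y i) \<in> borel_measurable D"
    by (intro borel_measurable_diff outcome_measurable borel_measurable_const i)+
  have mean: "(\<integral>y. p i - fst y i \<partial>D) = 0" "(\<integral>y. w i - snd y i \<partial>D) = 0"
    using integrable_reward[OF i] integrable_cost[OF i]
    by (simp_all add: mean_reward_def mean_cost_def D.prob_space)
  have range: "AE y in D. p i - fst y i \<in> {p i - 1..p i - 1 + 1}"
    "AE y in D. w i - snd y i \<in> {w i - Cmax..w i - Cmax + Cmax}"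
    using centered_reward(2)[OF i] centered_cost(2)[OF i] by (eventually_elim, simp)+
  note S = deviation_event_measurable[OF _ m]
  let ?x = "1 / (real n * real T) ^ 4"
  have "measure (draws T D) (deviation_events i m k) \<le> ?x + ?x + ?x + ?x"
    unfolding deviation_events_def
    by (intro order_trans[OF measure_Un_le] add_mono sets.Un S meas
        prob_deviation_event[OF _ m k _ centered_reward(2)[OF i]] prob_deviation_event[OF _ m k _ range(1)]
        prob_deviation_event[OF _ m k _ centered_cost(2)[OF i]] prob_deviation_event[OF _ m k _ range(2)]
        centered_reward(1) centered_cost(1) mean i) (use Cmax in auto)
  then show ?thesis by simp
qed

text \<open>Union bound over at most \<open>n * T\<^sup>2\<close> triples. The crude bound
  \<open>4 / T\<close> suffices because the gap summed over all rounds is at most linear in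
  \<open>T\<close>.\<close>

lemma prob_bad: "measure (draws T D) bad \<le> 4 / real T"
proof -
  let ?J = "({1..n} - {imin, imax}) \<times> {..<T} \<times> {1..T}"
  let ?x = "4 / (real n * real T) ^ 4"
  have "measure (draws T D) bad \<le> (\<Sum>j\<in>?J. measure (draws T D) ((\<lambda>(i, m, k). deviation_events i m (real k)) j))"
    unfolding bad_def
    by (rule M.finite_measure_subadditive_finite) (auto simp del: One_nat_def intro!: deviation_events_measurable)
  also have "\<dots> \<le> (\<Sum>j\<in>?J. ?x)"
    by (intro sum_mono) (auto simp del: One_nat_def intro!: prob_deviation_events)
  also have "\<dots> = real (card ({1..n} - {imin, imax})) * (real T * real T) * ?x"
    by (simp add: card_cartesian_product)
  also have "\<dots> \<le> real n * (real T * real T) * ?x"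
    using card_mono[of "{1..n}" "{1..n} - {imin, imax}"] by (intro mult_right_mono) auto
  also have "\<dots> = 4 / (real n ^ 3 * real T ^ 2)"
    using n2 T_pos by (simp add: field_simps power_numeral_reduce)
  also have "\<dots> \<le> 4 / real T"
  proof -
    have "real T * 1 \<le> real T ^ 2" using T_pos unfolding power2_eq_square by (intro mult_left_mono) auto
    moreover have "1 * real T ^ 2 \<le> real n ^ 3 * real T ^ 2" using n2 by (intro mult_right_mono) auto
    ultimately have "real T \<le> real n ^ 3 * real T ^ 2" by linarith
    then show ?thesis using T_pos n2 by (intro divide_left_mono) auto
  qed
  finally show ?thesis .
qed

text \<open>The actual play count is one of the values \<open>k\<close> in the union
  \<open>bad\<close>, so avoiding \<open>bad\<close> excludes all four deviations at that count;
  dividing by \<open>k\<close> passes from sums to averages.\<close>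

lemma confidence:
  assumes z: "z \<in> space (draws T D)" "z \<notin> bad" and i: "i \<in> {1..n} - {imin, imax}" and m: "m < T"
    and pos: "0 < play_count (run \<pi> z m) i"
  shows "\<bar>empirical_reward (run \<pi> z m) i - p i\<bar> \<le> radius n T (run \<pi> z m) i"
    and "\<bar>empirical_cost (run \<pi> z m) i - w i\<bar> \<le> Cmax * radius n T (run \<pi> z m) i"
proof -
  define k where "k = play_count (run \<pi> z m) i"
  define R where "R = (\<Sum>u=1..m. if arm z u = i then fst (z u) i else 0)"
  define C where "C = (\<Sum>u=1..m. if arm z u = i then snd (z u) i else 0)"
  have k_sum: "(\<Sum>u=1..m. of_bool (arm z u = i)) = real k"
    unfolding k_def play_count_run by (simp only: of_nat_sum of_nat_of_bool)
  have "k \<le> (\<Sum>u=1..m. 1)" unfolding k_def play_count_run by (intro sum_mono) auto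
  then have k: "0 < k" "k \<in> {1..T}" using m pos by (auto simp: k_def)
  have shift: "(\<Sum>u=1..m. if arm z u = i then f (z u) - a else 0)
        = (\<Sum>u=1..m. if arm z u = i then f (z u) else 0) - real k * a"
    and shift': "(\<Sum>u=1..m. if arm z u = i then a - f (z u) else 0)
        = real k * a - (\<Sum>u=1..m. if arm z u = i then f (z u) else 0)" for f :: "outcome \<Rightarrow> real" and a
    unfolding k_sum[symmetric] sum_distrib_right sum_subtractf[symmetric] by (auto intro!: sum.cong)
  have "z \<notin> deviation_events i m (real k)"
    using z i m k unfolding bad_def by blast
  then have dev: "\<bar>R - real k * p i\<bar> \<le> real k * rad k" "\<bar>C - real k * w i\<bar> \<le> Cmax * (real k * rad k)"
    using z(1) unfolding deviation_events_def deviation_event_def Un_iff mem_Collect_eq k_sum R_def C_def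
      shift[of "\<lambda>y. fst y i"] shift'[of _ "\<lambda>y. fst y i"] shift[of "\<lambda>y. snd y i"] shift'[of _ "\<lambda>y. snd y i"]
    by auto
  have emp: "empirical_reward (run \<pi> z m) i = R / k" "empirical_cost (run \<pi> z m) i = C / k"
    unfolding empirical_reward_def empirical_cost_def sum_observations_run R_def C_def k_def by (simp_all cong: if_cong)
  have radius: "radius n T (run \<pi> z m) i = rad k" by (simp add: radius_def rad_def k_def)
  have scale: "\<bar>S / k - a\<bar> \<le> b" if "\<bar>S - real k * a\<bar> \<le> real k * b" for S a b
  proof -
    have "S / k - a = (S - real k * a) / k" using k by (simp add: field_simps)
    then show ?thesis using that k by (simp add: pos_divide_le_eq mult.commute)
  qed
  show "\<bar>empirical_reward (run \<pi> z m) i - p i\<bar> \<le> radius n T (run \<pi> z m) i"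
    "\<bar>empirical_cost (run \<pi> z m) i - w i\<bar> \<le> Cmax * radius n T (run \<pi> z m) i"
    unfolding emp radius using dev by (auto intro!: scale simp: mult.left_commute)
qed

lemma radius_nonneg: "0 \<le> radius n T h i"
  using ln_pos by (simp add: radius_def)

section \<open>The Lagrangian gap of a round\<close>

text \<open>Regret in means with the constraint priced by the dual variable. Duality controls this
  quantity rather than the regret itself; \<open>noise\<close> and \<open>dual_drift\<close> account
  for the difference.\<close>

definition lagrangian_gap where
  "lagrangian_gap z t = w (arm z t) - Cstar - lam z t * (p (arm z t) - \<phi>)"

text \<open>The first bound pays for the event \<open>bad\<close>, the second for initialization,
  where the dual variable is 0, and the third for the two boundary rules.\<close>

lemma lagrangian_gap_crude:
  assumes t: "t \<in> {1..T}"
  shows "lagrangian_gap z t \<le> 2 * \<Lambda>"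
    and "t < n - 1 \<Longrightarrow> lagrangian_gap z t \<le> Cmax"
    and "n - 1 \<le> t \<Longrightarrow> lam z t \<le> 0 \<or> \<Lambda> \<le> lam z t \<Longrightarrow> lagrangian_gap z t \<le> 0"
proof -
  note range = means_range[OF arm_in[OF t], of z]
  show *: "lagrangian_gap z t \<le> Cmax" if "t < n - 1"
    using that range Cstar_nonneg by (simp add: lagrangian_gap_def lam_init)
  show **: "lagrangian_gap z t \<le> 0" if l: "n - 1 \<le> t" "lam z t \<le> 0 \<or> \<Lambda> \<le> lam z t"
    using t
  proof (cases rule: arm_cases[of t z])
    case high
    \<comment> \<open>The choice of \<open>\<Lambda>\<close>: once the price reaches it, the surplus
      success of \<open>imax\<close> pays for its cost.\<close>
    have "Cmax = \<Lambda> * (1 - \<phi>)" using phi by (simp add: \<Lambda>_def)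
    also have "\<dots> \<le> lam z t * (1 - \<phi>)" using high phi by (intro mult_right_mono) auto
    finally show ?thesis using high Cstar_nonneg by (simp add: lagrangian_gap_def boundary_means)
  next
    case low
    then have "lam z t * \<phi> \<le> 0" using phi by (simp add: mult_nonpos_nonneg)
    then show ?thesis using low Cstar_nonneg by (simp add: lagrangian_gap_def boundary_means)
  qed (use l in auto)
  show "lagrangian_gap z t \<le> 2 * \<Lambda>"
  proof (cases "n - 1 \<le> t \<and> 0 < lam z t \<and> lam z t < \<Lambda>")
    case True
    have "lam z t * \<phi> \<le> \<Lambda> * 1" using True phi Lam_pos by (intro mult_mono) auto
    moreover have "0 \<le> lam z t * p (arm z t)" using True range by simp
    ultimately show ?thesis
      using range Cstar_nonneg Lam_ge by (simp add: lagrangian_gap_def right_diff_distrib)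
  next
    case False
    then show ?thesis using * ** Lam_ge Lam_pos by (cases "n - 1 \<le> t") (force simp: not_le not_less)+
  qed
qed

text \<open>Optimism: the arg min of the corrected Lagrangian lies below the true Lagrangian of
  every arm. Undoing the correction at the played arm costs twice its radius, once with factor
  \<open>Cmax\<close> and once with factor \<open>lam z t\<close>, both at most
  \<open>\<Lambda>\<close>.\<close>

lemma lagrangian_gap_good:
  assumes z: "z \<in> space (draws T D)" "z \<notin> bad" and t: "t \<in> {1..T}" "n - 1 \<le> t"
  shows "lagrangian_gap z t \<le> 4 * \<Lambda> * radius n T (run \<pi> z (t - 1)) (arm z t)"
  using t(1)
proof (cases rule: arm_cases[of t z])
  case argmin
  let ?h = "run \<pi> z (t - 1)"
  let ?l = "lam z t"
  let ?C = "cost_lcb n T imin imax Cmax ?h" and ?R = "reward_ucb n T imin imax ?h" and ?r = "radius n T ?h"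
  have bounds: "?C i \<le> w i" "w i \<le> ?C i + 2 * (Cmax * ?r i)" "p i \<le> ?R i" "?R i \<le> p i + 2 * ?r i"
    if i: "i \<in> {1..n}" for i
  proof -
    have "?C i \<le> w i \<and> w i \<le> ?C i + 2 * (Cmax * ?r i) \<and> p i \<le> ?R i \<and> ?R i \<le> p i + 2 * ?r i"
    proof (cases "i \<in> {imin, imax}")
      case True
      then show ?thesis
        using boundary_means arms radius_nonneg[of ?h i] Cmax by (auto simp: cost_lcb_def reward_ucb_def)
    next
      case False
      have "0 < play_count ?h i" using play_count_pos t i False by auto
      moreover have "t - 1 < T" "i \<in> {1..n} - {imin, imax}" using t i False by auto
      ultimately show ?thesis
        using confidence[OF z, of i "t - 1"] False by (auto simp: cost_lcb_def reward_ucb_def abs_le_iff)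
    qed
    then show "?C i \<le> w i" "w i \<le> ?C i + 2 * (Cmax * ?r i)" "p i \<le> ?R i" "?R i \<le> p i + 2 * ?r i" by auto
  qed
  let ?i = "arm z t"
  \<comment> \<open>The \<open>v\<close> for weak duality is the true Lagrangian of the played arm,
    lowered by both corrections.\<close>
  have "w ?i - ?l * p ?i - 2 * (Cmax * ?r ?i) - ?l * (2 * ?r ?i) + ?l * \<phi> \<le> Cstar"
  proof (rule weak_duality)
    fix i assume i: "i \<in> {1..n}"
    have "?l * ?R ?i \<le> ?l * (p ?i + 2 * ?r ?i)"
      using bounds[OF argmin(4)] argmin(2) by (intro mult_left_mono) auto
    then have "w ?i - ?l * p ?i - 2 * (Cmax * ?r ?i) - ?l * (2 * ?r ?i) \<le> ?C ?i - ?l * ?R ?i"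
      using bounds(2)[OF argmin(4)] by (simp add: distrib_left)
    also have "\<dots> \<le> ?C i - ?l * ?R i" by (rule argmin(5)[OF i])
    also have "\<dots> \<le> w i - ?l * p i"
      using bounds[OF i] argmin(2) by (intro diff_mono mult_left_mono) auto
    finally show "w ?i - ?l * p ?i - 2 * (Cmax * ?r ?i) - ?l * (2 * ?r ?i) \<le> w i - ?l * p i" .
  qed (use argmin in simp)
  moreover have "?l * ?r ?i \<le> \<Lambda> * ?r ?i" "Cmax * ?r ?i \<le> \<Lambda> * ?r ?i"
    using argmin Lam_ge radius_nonneg by (auto intro!: mult_right_mono)
  ultimately show ?thesis by (simp add: lagrangian_gap_def right_diff_distrib)
qed (use t lagrangian_gap_crude(3)[OF t(1), of z] Lam_pos radius_nonneg[of "run \<pi> z (t - 1)" "arm z t"]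
      in \<open>auto intro: order_trans\<close>)

lemma sum_radius:
  "(\<Sum>t=1..T. radius n T (run \<pi> z (t - 1)) (arm z t))
     \<le> sqrt (2 * ln (real n * real T)) * (2 * sqrt (real n * real T))"
proof -
  have "(\<Sum>t=1..T. radius n T (run \<pi> z (t - 1)) (arm z t))
      = sqrt (2 * ln (real n * real T)) * (\<Sum>t=1..T. 1 / sqrt (real (play_count (run \<pi> z (t - 1)) (arm z t))))"
    by (simp add: radius_def real_sqrt_divide sum_distrib_left)
  also have "\<dots> \<le> sqrt (2 * ln (real n * real T)) * (2 * sqrt (real n * real T))"
    using ln_pos by (intro mult_left_mono sum_inverse_sqrt_play_count arm_in) auto
  finally show ?thesis .
qed

lemma sum_lagrangian_gap:
  assumes z: "z \<in> space (draws T D)"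
  shows "(\<Sum>t=1..T. lagrangian_gap z t)
     \<le> Cmax * real n + 4 * \<Lambda> * (sqrt (2 * ln (real n * real T)) * (2 * sqrt (real n * real T)))
        + 2 * \<Lambda> * real T * indicator bad z"
proof (cases "z \<in> bad")
  case True
  have "(\<Sum>t=1..T. lagrangian_gap z t) \<le> (\<Sum>t=1..T. 2 * \<Lambda>)"
    by (intro sum_mono lagrangian_gap_crude)
  moreover have "0 \<le> Cmax * real n + 4 * \<Lambda> * (sqrt (2 * ln (real n * real T)) * (2 * sqrt (real n * real T)))"
    using Cmax Lam_pos ln_pos by simp
  ultimately show ?thesis using True by (simp add: mult.commute)
next
  case False
  \<comment> \<open>The indicator of \<open>t < n\<close> covers the initialization rounds
    \<open>t < n - 1\<close>, and fewer than \<open>n\<close> rounds satisfy it.\<close>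
  have "(\<Sum>t=1..T. lagrangian_gap z t)
      \<le> (\<Sum>t=1..T. Cmax * of_bool (t < n) + 4 * \<Lambda> * radius n T (run \<pi> z (t - 1)) (arm z t))"
  proof (rule sum_mono)
    fix t assume t: "t \<in> {1..T}"
    show "lagrangian_gap z t \<le> Cmax * of_bool (t < n) + 4 * \<Lambda> * radius n T (run \<pi> z (t - 1)) (arm z t)"
    proof (cases "n - 1 \<le> t")
      case True
      have "0 \<le> Cmax * of_bool (t < n)" using Cmax by simp
      then show ?thesis using lagrangian_gap_good[OF z False t True] by linarith
    next
      case F: False
      have "0 \<le> 4 * \<Lambda> * radius n T (run \<pi> z (t - 1)) (arm z t)"
        using Lam_pos radius_nonneg by simp
      then show ?thesis using lagrangian_gap_crude(2)[OF t, of z] F by auto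
    qed
  qed
  also have "\<dots> = Cmax * (\<Sum>t=1..T. of_bool (t < n)) + 4 * \<Lambda> * (\<Sum>t=1..T. radius n T (run \<pi> z (t - 1)) (arm z t))"
    by (simp only: sum.distrib sum_distrib_left)
  also have "\<dots> \<le> Cmax * real n + 4 * \<Lambda> * (sqrt (2 * ln (real n * real T)) * (2 * sqrt (real n * real T)))"
  proof (intro add_mono mult_left_mono sum_radius)
    have "(\<Sum>t=1..T. of_bool (t < n)) = real (card ({1..T} \<inter> {t. t < n}))" by simp
    also have "card ({1..T} \<inter> {t. t < n}) \<le> card {..<n}" by (intro card_mono) auto
    finally show "(\<Sum>t=1..T. of_bool (t < n)) \<le> real n" by simp
  qed (use Cmax Lam_pos in auto)
  finally show ?thesis using False by simp
qed

section \<open>Assembling the regret bound\<close>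

text \<open>The constant collects 1 from initialization, 12 from the radii, 1/2 from the dual drift
  and 8 from the event \<open>bad\<close>, rounded up.\<close>

lemma expected_regret_bound:
  "expected_regret n T \<phi> D \<pi> \<le> 22 * (\<Lambda> * sqrt (real n * real T * ln (real n * real T)))"
proof -
  let ?L = "ln (real n * real T)" and ?s = "sqrt (real n * real T)"
  define B where "B = Cmax * real n + 4 * \<Lambda> * (sqrt (2 * ?L) * (2 * ?s)) + sqrt (real T) / 2"
  have T2: "2 \<le> T" using n2 nT by simp
  \<comment> \<open>Since \<open>n * T\<close> is at least 4, its logarithm is at least 1, which
    lets terms without a logarithm be absorbed.\<close>
  have "exp 1 \<le> (3::real)" by (rule exp_le)
  also have "\<dots> \<le> 2 * 2" by simp
  also have "\<dots> \<le> real n * real T" using n2 T2 by (intro mult_mono) auto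
  finally have L1: "1 \<le> ?L" using n2 T2 by (subst ln_ge_iff) auto
  let ?S = "?s * sqrt ?L"
  have s1: "1 \<le> sqrt ?L" using L1 by simp
  have S: "?s \<le> ?S" using mult_left_mono[OF s1, of ?s] by simp
  \<comment> \<open>Here \<open>n \<le> T\<close> absorbs the cost of initialization.\<close>
  have "real n \<le> ?s" using nT by (intro real_le_rsqrt) (simp add: power2_eq_square mult_left_mono)
  then have b1: "Cmax * real n \<le> \<Lambda> * ?S" using S Lam_ge Cmax by (intro mult_mono) auto
  have "sqrt 2 \<le> 3 / 2" by (rule real_le_lsqrt) (auto simp: power2_eq_square)
  then have "sqrt 2 * (\<Lambda> * ?S) \<le> 3 / 2 * (\<Lambda> * ?S)"
    using Lam_pos ln_pos by (intro mult_right_mono) auto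
  then have b2: "4 * \<Lambda> * (sqrt (2 * ?L) * (2 * ?s)) \<le> 12 * (\<Lambda> * ?S)"
    by (simp add: real_sqrt_mult mult_ac)
  have "1 * real T \<le> real n * real T" using n2 by (intro mult_right_mono) auto
  then have "sqrt (real T) \<le> ?s" by simp
  then have "sqrt (real T) \<le> ?S" using S by (rule order_trans)
  then have "1 * sqrt (real T) \<le> \<Lambda> * ?S" using Lam_ge Cmax by (intro mult_mono) auto
  then have b3: "sqrt (real T) \<le> \<Lambda> * ?S" by simp
  have "1 * 1 \<le> real n * real T" using n2 T2 by (intro mult_mono) auto
  then have "1 \<le> ?s" by simp
  then have "1 \<le> ?S" using S by (rule order_trans)
  then have "\<Lambda> * 1 \<le> \<Lambda> * ?S" using Lam_pos by (intro mult_left_mono) auto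
  then have b4: "\<Lambda> \<le> \<Lambda> * ?S" by simp

  have ind: "integrable (draws T D) (indicat_real bad)"
    by (rule integrable_real_indicator[OF bad_measurable]) (simp add: M.emeasure_eq_measure del: One_nat_def)
  have noise: "integrable (draws T D) (\<lambda>z. \<Sum>t=1..T. noise z t)"
    "(\<integral>z. (\<Sum>t=1..T. noise z t) \<partial>draws T D) = 0"
    by (auto intro!: Bochner_Integration.integrable_sum noise_mean_zero(1)
        simp: Bochner_Integration.integral_sum noise_mean_zero simp del: One_nat_def)
  have int: "integrable (draws T D) (\<lambda>z. (\<Sum>t=1..T. noise z t) + (B + 2 * \<Lambda> * real T * indicator bad z))"
    by (intro Bochner_Integration.integrable_add integrable_mult_right M.integrable_const noise(1) ind)
  have pointwise: "AE z in draws T D. (\<Sum>t=1..T. snd (z t) (arm z t) - Cstar)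
      \<le> (\<Sum>t=1..T. noise z t) + (B + 2 * \<Lambda> * real T * indicator bad z)"
    using draws_range AE_space
  proof eventually_elim
    case (elim z)
    \<comment> \<open>Exact decomposition of the regret of each round: the terms with
      \<open>lam z t\<close> cancel.\<close>
    have "(\<Sum>t=1..T. snd (z t) (arm z t) - Cstar)
        = (\<Sum>t=1..T. noise z t + lagrangian_gap z t + lam z t * (fst (z t) (arm z t) - \<phi>))"
      by (intro sum.cong) (auto simp: noise_eq lagrangian_gap_def algebra_simps)
    also have "\<dots> = (\<Sum>t=1..T. noise z t) + (\<Sum>t=1..T. lagrangian_gap z t)
        + (\<Sum>t=1..T. lam z t * (fst (z t) (arm z t) - \<phi>))"
      by (simp only: sum.distrib)
    finally show ?case
      using sum_lagrangian_gap[OF elim(2)] dual_drift[OF elim(1)] unfolding B_def by linarith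
  qed
  have "(\<integral>z. (\<Sum>t=1..T. noise z t) + (B + 2 * \<Lambda> * real T * indicator bad z) \<partial>draws T D)
      = B + 2 * \<Lambda> * real T * measure (draws T D) bad"
    using noise ind sets.sets_into_space[OF bad_measurable]
    by (simp add: Bochner_Integration.integral_add M.prob_space Int_absorb2 del: One_nat_def)
  also have "\<dots> \<le> B + 2 * \<Lambda> * real T * (4 / real T)"
    using prob_bad Lam_pos by (intro add_left_mono mult_left_mono) auto
  also have "\<dots> = B + 8 * \<Lambda>" using T2 by simp
  also have "\<dots> \<le> 22 * (\<Lambda> * ?S)"
    unfolding B_def using b1 b2 b3 b4 Lam_pos by linarith
  finally have bound: "(\<integral>z. (\<Sum>t=1..T. noise z t) + (B + 2 * \<Lambda> * real T * indicator bad z) \<partial>draws T D)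
      \<le> 22 * (\<Lambda> * ?S)" .
  have "expected_regret n T \<phi> D \<pi> \<le> 22 * (\<Lambda> * ?S)"
  \<comment> \<open>A non-integrable regret would have integral 0 by convention, and the bound is
    nonnegative; the case split replaces a proof of integrability.\<close>
  proof (cases "integrable (draws T D) (\<lambda>z. \<Sum>t=1..T. snd (z t) (arm z t) - Cstar)")
    case True
    from integral_mono_AE[OF this int pointwise] bound show ?thesis
      unfolding expected_regret_def by linarith
  next
    case False
    then show ?thesis
      using Lam_pos ln_pos unfolding expected_regret_def by (simp add: not_integrable_integral_eq)
  qed
  then show ?thesis by (simp add: real_sqrt_mult)
qed

end

theorem theorem2:
  fixes \<delta> :: real
  assumes "0 < \<delta>"
  shows "\<exists>K>0. \<forall>n :: nat \<Rightarrow> nat.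
    (\<forall>T. 2 \<le> n T) \<and> (\<lambda>T. real (n T)) \<in> o[sequentially](\<lambda>T. real T) \<longrightarrow>
    (\<forall>\<^sub>F T in sequentially.
      \<forall>(Cmax :: real) (\<phi> :: real) imin imax D \<pi>.
        1 \<le> Cmax \<and> \<delta> \<le> \<phi> \<and> \<phi> \<le> 1 - \<delta> \<and>
        bandit_instance (n T) imin imax Cmax D \<and>
        primal_dual_ACI (n T) T imin imax Cmax \<phi> (Cmax / (1 - \<phi>)) (1 / sqrt (real T)) \<pi> \<and>
        measurable_policy T D \<pi> \<longrightarrow>
        expected_regret (n T) T \<phi> D \<pi>
          \<le> K * (Cmax / (1 - \<phi>) * sqrt (real (n T) * real T * ln (real (n T) * real T))))"
proof (rule exI[of _ 22], intro conjI allI impI)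
  fix n :: "nat \<Rightarrow> nat"
  assume n: "(\<forall>T. 2 \<le> n T) \<and> (\<lambda>T. real (n T)) \<in> o[sequentially](\<lambda>T. real T)"
  \<comment> \<open>Taking the little-o constant 1 gives \<open>n T \<le> T\<close> eventually. The
    threshold depends on the sequence \<open>n\<close> alone, hence is uniform over all instances
    and policies.\<close>
  then have "\<forall>\<^sub>F T in sequentially. norm (real (n T)) \<le> 1 * norm (real T)"
    by (intro landau_o.smallD) auto
  then show "\<forall>\<^sub>F T in sequentially.
      \<forall>(Cmax :: real) (\<phi> :: real) imin imax D \<pi>.
        1 \<le> Cmax \<and> \<delta> \<le> \<phi> \<and> \<phi> \<le> 1 - \<delta> \<and>
        bandit_instance (n T) imin imax Cmax D \<and>
        primal_dual_ACI (n T) T imin imax Cmax \<phi> (Cmax / (1 - \<phi>)) (1 / sqrt (real T)) \<pi> \<and>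
        measurable_policy T D \<pi> \<longrightarrow>
        expected_regret (n T) T \<phi> D \<pi>
          \<le> 22 * (Cmax / (1 - \<phi>) * sqrt (real (n T) * real T * ln (real (n T) * real T)))"
  proof eventually_elim
    case (elim T)
    show ?case
    proof (intro allI impI)
      fix Cmax \<phi> :: real and imin imax D \<pi>
      assume "1 \<le> Cmax \<and> \<delta> \<le> \<phi> \<and> \<phi> \<le> 1 - \<delta> \<and>
        bandit_instance (n T) imin imax Cmax D \<and>
        primal_dual_ACI (n T) T imin imax Cmax \<phi> (Cmax / (1 - \<phi>)) (1 / sqrt (real T)) \<pi> \<and>
        measurable_policy T D \<pi>"
      then interpret aci_run "n T" T imin imax Cmax \<phi> D \<pi>
        using n elim assms by unfold_locales auto
      show "expected_regret (n T) T \<phi> D \<pi>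
          \<le> 22 * (Cmax / (1 - \<phi>) * sqrt (real (n T) * real T * ln (real (n T) * real T)))"
        using expected_regret_bound by (simp add: \<Lambda>_def)
    qed
  qed
qed simp

end
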